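(* Let $X$, $\ell$, $\mathcal S_0$, $\mathcal S_k$ ($k\in\mathcal K$), $\varepsilon_K$ and $\mathcal Q(\widehat{\mathbf C})$ be as defined in the context. Then the three-level optimization problem $$\min_{\mathbf{x} \in X}\ \max_{\widehat{\mathbf{C}}} \Big\{ \max_{\mathbb{Q} \in \mathcal{Q}(\widehat{\mathbf{C}})} \mathbb{E}_{\mathbb{Q}} \{\ell(\mathbf{x}, \mathbf{c})\}:\ \hat{\mathbf{c}}^{(k)} \in \mathcal{S}_k \ \ \forall k \in \mathcal{K} \Big\}$$ can be reformulated as the mixed-integer linear programming problem $$\begin{aligned} \min_{\mathbf{x}, \lambda, \boldsymbol{\nu}, \boldsymbol{\gamma}}\quad & \lambda \varepsilon_K + \frac{1}{K} \sum_{k = 1}^K \mathbf{b}^{(0)\top} \boldsymbol{\nu}^{(k)} + \sum_{k = 1}^K \mathbf{b}^{(k)\top} \boldsymbol{\gamma}^{(k)} + \mathbf{t}^\top_1 \mathbf{x} + t_0 \\ \text{s.t.}\quad & \tfrac{1}{K}\big(\mathbf{T}\mathbf{x} + \mathbf{t}_2 - \mathbf{B}^{(0)\top} \boldsymbol{\nu}^{(k)}\big) = \mathbf{B}^{(k)\top} \boldsymbol{\gamma}^{(k)} \quad \forall k \in \mathcal{K}, \\ & -\lambda \mathbf{1} \leq \mathbf{T} \mathbf{x} + \mathbf{t}_2 - \mathbf{B}^{(0)\top} \boldsymbol{\nu}^{(k)} \leq \lambda \mathbf{1} \quad \forall k \in \mathcal{K}, \\ & \boldsymbol{\nu}^{(k)}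 \geq \mathbf{0},\ \boldsymbol{\gamma}^{(k)} \geq \mathbf{0} \quad \forall k \in \mathcal{K}, \\ & \lambda \geq 0,\quad \mathbf{x} \in X, \end{aligned}$$ where $\lambda\in\mathbb R$, $\boldsymbol\nu^{(k)}\in\mathbb R^{w_0}$, $\boldsymbol\gamma^{(k)}\in\mathbb R^{w_k}$. That is, the two problems have the same optimal value, and $\mathbf x\in X$ is optimal for the three-level problem if and only if it is the $\mathbf x$-component of an optimal solution of the mixed-integer linear program.
   Context: Index set: $K\ge 1$ is an integer and $\mathcal K=\{1,\dots,K\}$. Vector inequalities are component-wise, and $\mathbf 1$ is the all-ones vector. Feasible decisions: $n=n_1+n_2$ with $n_1\in\mathbb Z_{+}$, $n_2\in\mathbb Z_{++}$ (nonnegative, resp. positive integers), and $$X=\{(\mathbf x^{(1)},\mathbf x^{(2)})\in\mathbb R^{n_1}_+\times\mathbb Z^{n_2}_+:\ \mathbf G_1\mathbf x^{(1)}+\mathbf G_2\mathbf x^{(2)}\le\mathbf g\},$$ with $\mathbf G_1\in\mathbb R^{m\times n_1}$, $\mathbf G_2\in\mathbb R^{m\times n_2}$, $\mathbf g\in\mathbb R^m$, $m\in\mathbb Z_{++}$; $\mathbf x=(\mathbf x^{(1)},\mathbf x^{(2)})\in\mathbb R^n$. Loss function: $\ell(\mathbf x,\mathbf c)=\mathbf c^\top\mathbf T\mathbf x+\mathbf t_1^\top\mathbf x+\mathbf t_2^\top\mathbf c+t_0$, with $\mathbf T=\mathbf T^\top\in\mathbb R^{n\times n}$, $\mathbf t_1,\mathbf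 t_2\in\mathbb R^n$, $t_0\in\mathbb R$. Support set: $\mathcal S_0=\{\mathbf c'\in\mathbb R^n:\mathbf B^{(0)}\mathbf c'\le\mathbf b^{(0)}\}$ is nonempty and bounded, with $\mathbf B^{(0)}\in\mathbb R^{w_0\times n}$, $\mathbf b^{(0)}\in\mathbb R^{w_0}$, $w_0\in\mathbb Z_{++}$. Data uncertainty sets: for each $k\in\mathcal K$, $\mathcal S_k=\{\mathbf c'\in\mathbb R^n:\mathbf B^{(k)}\mathbf c'\le\mathbf b^{(k)}\}\subseteq\mathcal S_0$ is nonempty, with $\mathbf B^{(k)}\in\mathbb R^{w_k\times n}$, $\mathbf b^{(k)}\in\mathbb R^{w_k}$, $w_k\in\mathbb Z_{++}$. Data set: $\widehat{\mathbf C}=(\hat{\mathbf c}^{(1)},\dots,\hat{\mathbf c}^{(K)})$ with $\hat{\mathbf c}^{(k)}\in\mathbb R^n$; its empirical distribution is $\widehat{\mathbb Q}_K=\frac1K\sum_{k=1}^K\delta_{\hat{\mathbf c}^{(k)}}$, where $\delta_{\mathbf z}$ is the Dirac point mass at $\mathbf z$. Ambiguity set: $\mathcal Q_0(\mathcal S_0)$ is the set of probability distributions supported on $\mathcal S_0$. The type-1 Wasserstein distance with respect to the $l_1$-norm is $$W^1(\mathbb Q,\mathbb Q')=\inf_{\pi\in\Pi(\mathbb Q,\mathbb Q')}\int_{\mathcal S_0\times\mathcal S_0}\|\mathbf c-\mathbf c'\|_1\,\pi(\mathrm d\mathbf c,\mathrm d\mathbf c'),$$ where $\Pi(\mathbb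 Q,\mathbb Q')$ is the set of joint distributions on $\mathcal S_0\times\mathcal S_0$ with marginals $\mathbb Q$ and $\mathbb Q'$. For a given radius $\varepsilon_K>0$, $$\mathcal Q(\widehat{\mathbf C})=\{\mathbb Q\in\mathcal Q_0(\mathcal S_0):\ W^1(\widehat{\mathbb Q}_K,\mathbb Q)\le\varepsilon_K\}.$$ The optimal value of a minimization problem is understood as an infimum in $[-\infty,+\infty]$. *)

theory Defs
  imports "HOL-Probability.Probability"
begin

text \<open>
  Decisions and cost vectors live in \<^typ>\<open>real ^ 'n\<close>. The set \<open>J\<close> collects the integer coordinates,
  so \<open>- J\<close> (possibly empty) collects the continuous ones; \<open>G\<close> is the block matrix \<open>[G\<^sub>1 G\<^sub>2]\<close>.
\<close>

definition feasible_decisions ::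
  "'n::finite set \<Rightarrow> real ^ 'n ^ 'm::finite \<Rightarrow> real ^ 'm \<Rightarrow> (real ^ 'n) set" where
  "feasible_decisions J G g = {x. 0 \<le> x \<and> (\<forall>i\<in>J. x $ i \<in> \<int>) \<and> G *v x \<le> g}"

definition loss ::
  "real ^ 'n ^ 'n::finite \<Rightarrow> real ^ 'n \<Rightarrow> real ^ 'n \<Rightarrow> real \<Rightarrow> real ^ 'n \<Rightarrow> real ^ 'n \<Rightarrow> real" where
  "loss T t1 t2 t0 x c = c \<bullet> (T *v x) + t1 \<bullet> x + t2 \<bullet> c + t0"

text \<open>
  The number of rows of the matrices describing the uncertainty sets depends on the index of the
  set. Hence a matrix with \<open>w\<close> rows is a function giving row \<open>j\<close> for \<open>j < w\<close>, and a vector with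
  \<open>w\<close> entries is a function on \<open>nat\<close>; values at indices \<open>\<ge> w\<close> are irrelevant.
\<close>

definition ineq_set :: "nat \<Rightarrow> (nat \<Rightarrow> real ^ 'n::finite) \<Rightarrow> (nat \<Rightarrow> real) \<Rightarrow> (real ^ 'n) set" where
  "ineq_set w B b = {c. \<forall>j<w. B j \<bullet> c \<le> b j}"

definition transpose_mult :: "nat \<Rightarrow> (nat \<Rightarrow> real ^ 'n::finite) \<Rightarrow> (nat \<Rightarrow> real) \<Rightarrow> real ^ 'n" where
  "transpose_mult w B u = (\<Sum>j<w. u j *\<^sub>R B j)"

definition l1_norm :: "real ^ 'n::finite \<Rightarrow> real" where
  "l1_norm c = (\<Sum>i\<in>UNIV. \<bar>c $ i\<bar>)"

definition empirical :: "nat \<Rightarrow> (nat \<Rightarrow> real ^ 'n::finite) \<Rightarrow> (real ^ 'n) measure" where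
  "empirical K C = measure_of UNIV (sets borel)
     (\<lambda>A. ennreal (1 / real K) * (\<Sum>k\<in>{1..K}. emeasure (return borel (C k)) A))"

lemma sets_empirical [simp, measurable_cong]: "sets (empirical K C) = sets borel"
  unfolding empirical_def by (metis sets.sigma_sets_eq sets_measure_of space_borel subset_UNIV Pow_UNIV)

lemma space_empirical [simp]: "space (empirical K C) = UNIV"
  unfolding empirical_def by (simp add: space_measure_of_conv)

text \<open>The function used in \<open>empirical\<close> is indeed a measure, so \<open>measure_of\<close> does not collapse to 0.\<close>

lemma emeasure_empirical:
  assumes "A \<in> sets borel"
  shows "emeasure (empirical K C) A
    = ennreal (1 / real K) * (\<Sum>k\<in>{1..K}. emeasure (return borel (C k)) A)"
proof (rule emeasure_measure_of[OF empirical_def])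
  show "A \<in> sets (empirical K C)" using assms by simp
  show "positive (sets (empirical K C))
     (\<lambda>A. ennreal (1 / real K) * (\<Sum>k\<in>{1..K}. emeasure (return borel (C k)) A))"
    by (simp add: positive_def)
  show "countably_additive (sets (empirical K C))
     (\<lambda>A. ennreal (1 / real K) * (\<Sum>k\<in>{1..K}. emeasure (return borel (C k)) A))"
  proof (rule countably_additiveI)
    fix F :: "nat \<Rightarrow> (real ^ 'a) set"
    assume F: "range F \<subseteq> sets (empirical K C)" "disjoint_family F"
    have "(\<Sum>i. emeasure (return borel (C k)) (F i)) = emeasure (return borel (C k)) (\<Union> (range F))" for k
      using F by (intro suminf_emeasure) auto
    then show "(\<Sum>i. ennreal (1 / real K) * (\<Sum>k\<in>{1..K}. emeasure (return borel (C k)) (F i)))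
       = ennreal (1 / real K) * (\<Sum>k\<in>{1..K}. emeasure (return borel (C k)) (\<Union> (range F)))"
      by (simp add: ennreal_suminf_cmult suminf_sum)
  qed
qed auto

definition distributions_on :: "(real ^ 'n::finite) set \<Rightarrow> (real ^ 'n) measure set" where
  "distributions_on S = {Q. prob_space Q \<and> sets Q = sets borel \<and> emeasure Q S = 1}"

definition couplings ::
  "(real ^ 'n::finite) set \<Rightarrow> (real ^ 'n) measure \<Rightarrow> (real ^ 'n) measure
    \<Rightarrow> ((real ^ 'n) \<times> (real ^ 'n)) measure set" where
  "couplings S P Q = {\<pi>. prob_space \<pi> \<and> sets \<pi> = sets (borel \<Otimes>\<^sub>M borel) \<and> emeasure \<pi> (S \<times> S) = 1 \<and>
     distr \<pi> borel fst = P \<and> distr \<pi> borel snd = Q}"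

definition wasserstein1 ::
  "(real ^ 'n::finite) set \<Rightarrow> (real ^ 'n) measure \<Rightarrow> (real ^ 'n) measure \<Rightarrow> ennreal" where
  "wasserstein1 S P Q =
     (INF \<pi>\<in>couplings S P Q. \<integral>\<^sup>+p\<in>S \<times> S. ennreal (l1_norm (fst p - snd p)) \<partial>\<pi>)"

definition ambiguity_set ::
  "nat \<Rightarrow> (real ^ 'n::finite) set \<Rightarrow> real \<Rightarrow> (nat \<Rightarrow> real ^ 'n) \<Rightarrow> (real ^ 'n) measure set" where
  "ambiguity_set K S0 \<epsilon> C =
     {Q \<in> distributions_on S0. wasserstein1 S0 (empirical K C) Q \<le> ennreal \<epsilon>}"

text \<open>Here \<open>S 0\<close> is the support set and \<open>S k\<close>, for \<open>1 \<le> k \<le> K\<close>, are the data uncertainty sets.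
  The Bochner integral is genuine for the intended integrands: they are affine, hence bounded on the
  bounded set \<open>S 0\<close>, which carries all of \<open>Q\<close>.\<close>

definition worst_case_expectation ::
  "nat \<Rightarrow> (nat \<Rightarrow> (real ^ 'n::finite) set) \<Rightarrow> real \<Rightarrow> (real ^ 'n \<Rightarrow> real) \<Rightarrow> ereal" where
  "worst_case_expectation K S \<epsilon> f =
     (SUP C\<in>{C. \<forall>k\<in>{1..K}. C k \<in> S k}. SUP Q\<in>ambiguity_set K (S 0) \<epsilon> C. ereal (\<integral>c. f c \<partial>Q))"

text \<open>The components of a point are \<open>x\<close>, the scalar multiplier written \<open>l\<close> below, and the families
  \<open>\<nu>\<close> and \<open>\<gamma>\<close>, where \<open>\<nu> k\<close> has \<open>w 0\<close> and \<open>\<gamma> k\<close> has \<open>w k\<close> relevant entries, \<open>1 \<le> k \<le> K\<close>.\<close>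

type_synonym 'n milp_point =
  "(real ^ 'n) \<times> real \<times> (nat \<Rightarrow> nat \<Rightarrow> real) \<times> (nat \<Rightarrow> nat \<Rightarrow> real)"

definition milp_objective ::
  "nat \<Rightarrow> real \<Rightarrow> (nat \<Rightarrow> nat) \<Rightarrow> (nat \<Rightarrow> nat \<Rightarrow> real) \<Rightarrow> real ^ 'n::finite \<Rightarrow> real
    \<Rightarrow> 'n milp_point \<Rightarrow> real" where
  "milp_objective K \<epsilon> w b t1 t0 = (\<lambda>(x, l, \<nu>, \<gamma>).
     l * \<epsilon> + 1 / real K * (\<Sum>k=1..K. \<Sum>j<w 0. b 0 j * \<nu> k j)
       + (\<Sum>k=1..K. \<Sum>j<w k. b k j * \<gamma> k j) + t1 \<bullet> x + t0)"

definition milp_feasible ::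
  "nat \<Rightarrow> (real ^ 'n::finite) set \<Rightarrow> (nat \<Rightarrow> nat) \<Rightarrow> (nat \<Rightarrow> nat \<Rightarrow> real ^ 'n)
    \<Rightarrow> real ^ 'n ^ 'n \<Rightarrow> real ^ 'n \<Rightarrow> 'n milp_point set" where
  "milp_feasible K X w B T t2 = {(x, l, \<nu>, \<gamma>).
     (\<forall>k\<in>{1..K}. (1 / real K) *\<^sub>R (T *v x + t2 - transpose_mult (w 0) (B 0) (\<nu> k))
                   = transpose_mult (w k) (B k) (\<gamma> k)) \<and>
     (\<forall>k\<in>{1..K}. - (l *\<^sub>R 1) \<le> T *v x + t2 - transpose_mult (w 0) (B 0) (\<nu> k) \<and>
                   T *v x + t2 - transpose_mult (w 0) (B 0) (\<nu> k) \<le> l *\<^sub>R 1) \<and>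
     (\<forall>k\<in>{1..K}. (\<forall>j<w 0. 0 \<le> \<nu> k j) \<and> (\<forall>j<w k. 0 \<le> \<gamma> k j)) \<and>
     0 \<le> l \<and> x \<in> X}"

end

(*
  The statement holds fibrewise: for each fixed x the worst-case expectation equals the minimum of
  the linear program in the remaining variables, and that minimum is attained.  For the upper bound,
  a feasible dual point bounds (T x + t2) . y by l |c(k) - y|_1 plus a constant, for every k and every
  y in S 0; integrating this against a nearly optimal coupling gives weak duality.  For the lower
  bound, restrict the adversary to data sets c and empirical distributions of K points q subject to
  sum_k |c(k) - q(k)|_1 <= K eps.  This is a linear program, and an affine Farkas lemma produces a
  feasible dual point whose objective is at most its supremum.
*)

theory Submission
  imports Defs "HOL-Analysis.Finite_Function_Topology"
begin

section \<open>Farkas lemmas for finitely many linear inequalities on a real vector space\<close>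

text \<open>Induction on the set of inequalities. If dropping \<open>m\<close> breaks the
  implication, a witness of the failure serves as a direction along which everything is projected
  onto the kernel of \<open>f m\<close>; there only the inequalities in \<open>J\<close> remain. No
  topology or finite dimension enters.\<close>

lemma farkas_homogeneous:
  fixes f :: "'j \<Rightarrow> 'v::real_vector \<Rightarrow> real"
  assumes "finite J"
    and "\<And>j. j \<in> J \<Longrightarrow> linear (f j)" and "linear g"
    and "\<And>x. (\<And>j. j \<in> J \<Longrightarrow> f j x \<le> 0) \<Longrightarrow> g x \<le> 0"
  shows "\<exists>u. (\<forall>j\<in>J. 0 \<le> u j) \<and> (\<forall>x. g x = (\<Sum>j\<in>J. u j * f j x))"
  using assms
proof (induction J arbitrary: f g rule: finite_induct)
  case empty
  have "g x = 0" for x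
    using empty.prems(3)[of x] empty.prems(3)[of "- x"] linear_neg[OF empty.prems(2), of x] by simp
  then show ?case by simp
next
  case (insert m J)
  have lin: "linear (f j)" if "j \<in> J" for j using insert.prems(1) that by simp
  have linm: "linear (f m)" using insert.prems(1) by simp
  show ?case
  \<comment> \<open>If the inequality \<open>m\<close> is redundant, it receives weight 0.\<close>
  proof (cases "\<forall>x. (\<forall>j\<in>J. f j x \<le> 0) \<longrightarrow> g x \<le> 0")
    case True
    then obtain u where u: "\<forall>j\<in>J. 0 \<le> u j" "\<forall>x. g x = (\<Sum>j\<in>J. u j * f j x)"
      using insert.IH[of f g] lin insert.prems(2) by blast
    have "(\<Sum>j\<in>J. u j * f j x) = (\<Sum>j\<in>J. (u(m := 0)) j * f j x)" for x
      using insert.hyps(2) by (intro sum.cong) auto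
    then show ?thesis
      using u insert.hyps by (intro exI[of _ "u(m := 0)"]) auto
  next
    case False
    then obtain y0 where y0: "\<And>j. j \<in> J \<Longrightarrow> f j y0 \<le> 0" "g y0 > 0" by force
    \<comment> \<open>Otherwise \<open>y0\<close> would satisfy all inequalities although
      \<open>g y0 > 0\<close>.\<close>
    have pos: "f m y0 > 0"
      using insert.prems(3)[of y0] y0 by force
    define y where "y = (1 / f m y0) *\<^sub>R y0"
    have y: "\<And>j. j \<in> J \<Longrightarrow> f j y \<le> 0" "g y > 0" "f m y = 1"
      using y0 pos
      by (auto simp: y_def linear_scale[OF lin] linear_scale[OF linm]
          linear_scale[OF insert.prems(2)] divide_simps)
    \<comment> \<open>The projection onto the kernel of \<open>f m\<close> along \<open>y\<close>.
      On its range the inequality \<open>m\<close> holds trivially, so the induction hypothesis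
      applies to the compositions with \<open>P\<close>.\<close>
    define P where "P x = x - f m x *\<^sub>R y" for x
    have linP: "linear P"
      unfolding P_def
      by (intro linear_compose_sub linear_id[unfolded id_def] linearI)
        (auto simp: linear_add[OF linm] linear_scale[OF linm] algebra_simps)
    have mP: "f m (P x) = 0" for x
      by (simp add: P_def linear_diff[OF linm] linear_scale[OF linm] y)
    have eP: "h (P x) = h x - f m x * h y" if "linear h" for h :: "'v \<Rightarrow> real" and x
      by (simp add: P_def linear_diff[OF that] linear_scale[OF that])
    have "\<exists>u. (\<forall>j\<in>J. 0 \<le> u j) \<and> (\<forall>x. (g \<circ> P) x = (\<Sum>j\<in>J. u j * (f j \<circ> P) x))"
    proof (rule insert.IH)
      show "linear (f j \<circ> P)" if "j \<in> J" for j using lin that linP by (intro linear_compose)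
      show "linear (g \<circ> P)" using insert.prems(2) linP by (intro linear_compose)
      show "(g \<circ> P) x \<le> 0" if "\<And>j. j \<in> J \<Longrightarrow> (f j \<circ> P) x \<le> 0" for x
        using insert.prems(3)[of "P x"] that mP by fastforce
    qed
    then obtain u where u: "\<And>j. j \<in> J \<Longrightarrow> 0 \<le> u j"
      and gP: "\<And>x. g (P x) = (\<Sum>j\<in>J. u j * f j (P x))" by auto
    \<comment> \<open>Expanding \<open>P x\<close> in the identity for \<open>g (P x)\<close> leaves
      exactly this coefficient at \<open>f m x\<close>. It is nonnegative since
      \<open>g y > 0\<close> while each \<open>f j y\<close> is at most 0.\<close>
    define um where "um = g y - (\<Sum>j\<in>J. u j * f j y)"
    have "um \<ge> 0"
      using sum_nonpos[of J "\<lambda>j. u j * f j y"] y u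
      by (simp add: um_def mult_nonneg_nonpos)
    have gx: "g x = um * f m x + (\<Sum>j\<in>J. u j * f j x)" for x
    proof -
      have "g x - f m x * g y = (\<Sum>j\<in>J. u j * (f j x - f m x * f j y))"
        using gP[of x] by (simp add: eP insert.prems(2) lin)
      then show ?thesis
        by (simp add: um_def algebra_simps sum_subtractf sum_distrib_left sum_distrib_right)
    qed
    have "(\<Sum>j\<in>J. u j * f j x) = (\<Sum>j\<in>J. (u(m := um)) j * f j x)" for x
      using insert.hyps(2) by (intro sum.cong) auto
    then show ?thesis
      using u gx \<open>um \<ge> 0\<close> insert.hyps by (intro exI[of _ "u(m := um)"]) auto
  qed
qed

text \<open>Homogenisation: at level \<open>t > 0\<close> one rescales to \<open>t = 1\<close>; at \<open>t = 0\<close> one moves from the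
  feasible point along a recession direction.\<close>

lemma farkas_affine:
  fixes f :: "'j \<Rightarrow> 'v::real_vector \<Rightarrow> real"
  assumes J: "finite J"
    and lin: "\<And>j. j \<in> J \<Longrightarrow> linear (f j)" and ling: "linear g"
    and x0: "\<And>j. j \<in> J \<Longrightarrow> f j x0 \<le> b j"
    and bound: "\<And>x. (\<And>j. j \<in> J \<Longrightarrow> f j x \<le> b j) \<Longrightarrow> g x \<le> \<beta>"
  shows "\<exists>u. (\<forall>j\<in>J. 0 \<le> u j) \<and> (\<forall>x. g x = (\<Sum>j\<in>J. u j * f j x)) \<and> (\<Sum>j\<in>J. u j * b j) \<le> \<beta>"
proof -
  \<comment> \<open>The second component of a pair is the level; the index \<open>None\<close>
    carries the constraint that it be nonnegative.\<close>
  define F :: "'j option \<Rightarrow> 'v \<times> real \<Rightarrow> real" where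
    "F i p = (case i of None \<Rightarrow> - snd p | Some j \<Rightarrow> f j (fst p) - b j * snd p)" for i p
  define J' where "J' = insert None (Some ` J)"
  have "\<exists>u. (\<forall>i\<in>J'. 0 \<le> u i) \<and> (\<forall>p. g (fst p) - \<beta> * snd p = (\<Sum>i\<in>J'. u i * F i p))"
  proof (rule farkas_homogeneous)
    show "finite J'" using J by (simp add: J'_def)
    show "linear (F i)" if "i \<in> J'" for i
      using that by (auto simp: J'_def F_def algebra_simps linear_add[OF lin] linear_scale[OF lin]
          intro!: linearI)
    show "linear (\<lambda>p. g (fst p) - \<beta> * snd p)"
      by (auto simp: algebra_simps linear_add[OF ling] linear_scale[OF ling] intro!: linearI)
  next
    fix p assume *: "\<And>i. i \<in> J' \<Longrightarrow> F i p \<le> 0"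
    obtain x t where p: "p = (x, t)" by (cases p)
    have t: "t \<ge> 0" using *[of None] by (simp add: J'_def F_def p)
    have fx: "f j x \<le> b j * t" if "j \<in> J" for j using *[of "Some j"] that by (simp add: J'_def F_def p)
    show "g (fst p) - \<beta> * snd p \<le> 0"
    proof (cases "t = 0")
      case False
      with t have "t > 0" by simp
      have "g ((1/t) *\<^sub>R x) \<le> \<beta>"
        using fx \<open>t > 0\<close> by (intro bound) (simp add: linear_scale[OF lin] divide_simps)
      then show ?thesis using \<open>t > 0\<close> by (simp add: p linear_scale[OF ling] divide_simps mult.commute)
    next
      case True
      have step: "g x0 + s * g x \<le> \<beta>" if "s \<ge> 0" for s
      proof -
        have "f j (x0 + s *\<^sub>R x) \<le> b j" if "j \<in> J" for j
          using x0[OF that] fx[OF that] True \<open>s \<ge> 0\<close> mult_nonneg_nonpos[of s "f j x"]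
          by (simp add: linear_add[OF lin[OF that]] linear_scale[OF lin[OF that]])
        then have "g (x0 + s *\<^sub>R x) \<le> \<beta>" by (rule bound)
        then show ?thesis by (simp add: linear_add[OF ling] linear_scale[OF ling])
      qed
      have "g x \<le> 0"
      proof (rule ccontr)
        assume "\<not> g x \<le> 0"
        moreover have "g x0 \<le> \<beta>" using x0 by (rule bound)
        \<comment> \<open>The step length is chosen so that \<open>g x0 + s * g x\<close> equals
          \<open>\<beta> + 1\<close>.\<close>
        ultimately show False
          using step[of "(\<beta> - g x0 + 1) / g x"] by simp
      qed
      with True show ?thesis by (simp add: p)
    qed
  qed
  then obtain u where u: "\<And>i. i \<in> J' \<Longrightarrow> 0 \<le> u i"
    and eq: "\<And>p. g (fst p) - \<beta> * snd p = (\<Sum>i\<in>J'. u i * F i p)" by blast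
  have sum_J': "(\<Sum>i\<in>J'. h i) = h None + (\<Sum>j\<in>J. h (Some j))" for h :: "_ \<Rightarrow> real"
    using J by (simp add: J'_def sum.reindex)
  have "g x = (\<Sum>j\<in>J. u (Some j) * f j x)" for x
    using eq[of "(x, 0)"] by (simp add: sum_J' F_def)
  \<comment> \<open>At the point \<open>(0, 1)\<close> the identity says that this sum plus
    \<open>u None\<close> equals \<open>\<beta>\<close>.\<close>
  moreover have "(\<Sum>j\<in>J. u (Some j) * b j) \<le> \<beta>"
  proof -
    have "(\<Sum>j\<in>J. u (Some j) * (f j 0 - b j)) = (\<Sum>j\<in>J. - (u (Some j) * b j))"
      by (intro sum.cong) (simp_all add: linear_0[OF lin])
    moreover have "0 \<le> u None" by (rule u) (simp add: J'_def)
    ultimately show ?thesis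
      using eq[of "(0, 1)"] by (simp add: sum_J' F_def linear_0[OF ling] sum_negf)
  qed
  ultimately show ?thesis
    using u by (intro exI[of _ "\<lambda>j. u (Some j)"]) (auto simp: J'_def)
qed

section \<open>Empirical distributions as images of the uniform distribution on indices\<close>

text \<open>With this description integrals become finite averages, and pushing the same index
  distribution forward to pairs produces couplings.\<close>

lemma empirical_eq_distr:
  assumes "K \<ge> 1"
  shows "empirical K C = distr (measure_pmf (pmf_of_set {1..K})) borel C"
proof (rule measure_eqI)
  fix A assume "A \<in> sets (empirical K C)"
  then have A: "A \<in> sets borel" by simp
  have "emeasure (distr (measure_pmf (pmf_of_set {1..K})) borel C) A
      = (\<integral>\<^sup>+ k. indicator A (C k) \<partial>measure_pmf (pmf_of_set {1..K}))"
    using A by (simp add: nn_integral_indicator[symmetric] nn_integral_distr del: nn_integral_indicator)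
  also have "\<dots> = (\<Sum>k\<in>{1..K}. indicator A (C k)) / ennreal (real K)"
    using assms by (subst nn_integral_pmf_of_set) (auto simp: ennreal_of_nat_eq_real_of_nat)
  also have "\<dots> = emeasure (empirical K C) A"
    using assms A
    by (simp add: emeasure_empirical divide_ennreal_def inverse_ennreal mult.commute inverse_eq_divide)
  finally show "emeasure (empirical K C) A
      = emeasure (distr (measure_pmf (pmf_of_set {1..K})) borel C) A" ..
qed simp

lemma integral_empirical:
  fixes f :: "real ^ 'n::finite \<Rightarrow> real"
  assumes "K \<ge> 1" "f \<in> borel_measurable borel"
  shows "(\<integral>c. f c \<partial>empirical K C) = (\<Sum>k=1..K. f (C k)) / real K"
  using assms by (simp add: empirical_eq_distr integral_distr integral_pmf_of_set)

section \<open>Transport cost and the upper bound on expectations\<close>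

lemma l1_norm_measurable [measurable]: "l1_norm \<in> borel_measurable borel"
  unfolding l1_norm_def[abs_def] by measurable

lemma l1_norm_nonneg: "0 \<le> l1_norm x"
  by (simp add: l1_norm_def sum_nonneg)

text \<open>The slack \<open>\<delta>\<close> avoids having to know that the infimum defining the
  Wasserstein distance is attained.\<close>

lemma exists_cheap_coupling:
  assumes "Q \<in> ambiguity_set K S \<epsilon> C" and "\<epsilon> \<ge> 0" and "\<delta> > 0" and "S \<in> sets borel"
  obtains \<pi> where "\<pi> \<in> couplings S (empirical K C) Q"
    and "integrable \<pi> (\<lambda>p. l1_norm (fst p - snd p))"
    and "(\<integral>p. l1_norm (fst p - snd p) \<partial>\<pi>) \<le> \<epsilon> + \<delta>"
proof -
  have "wasserstein1 S (empirical K C) Q < ennreal (\<epsilon> + \<delta>)"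
    using assms by (auto simp: ambiguity_set_def ennreal_less_iff intro: le_less_trans)
  then obtain \<pi> where \<pi>: "\<pi> \<in> couplings S (empirical K C) Q"
    and cost: "(\<integral>\<^sup>+p\<in>S \<times> S. ennreal (l1_norm (fst p - snd p)) \<partial>\<pi>) < ennreal (\<epsilon> + \<delta>)"
    unfolding wasserstein1_def by (auto simp: INF_less_iff)
  from \<pi> interpret prob_space \<pi> by (simp add: couplings_def)
  from \<pi> have sets[measurable_cong]: "sets \<pi> = sets (borel \<Otimes>\<^sub>M borel)" by (simp add: couplings_def)
  \<comment> \<open>Since \<open>S \<times> S\<close> has full mass, the cost restricted to it
    equals the unrestricted cost.\<close>
  have "AE p in \<pi>. p \<in> S \<times> S"
    using \<pi> assms(4) by (intro AE_prob_1) (auto simp: couplings_def measure_def)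
  then have "(\<integral>\<^sup>+p. ennreal (l1_norm (fst p - snd p)) \<partial>\<pi>)
      = (\<integral>\<^sup>+p\<in>S \<times> S. ennreal (l1_norm (fst p - snd p)) \<partial>\<pi>)"
    by (intro nn_integral_cong_AE) (auto elim: eventually_mono)
  with cost have c: "(\<integral>\<^sup>+p. ennreal (l1_norm (fst p - snd p)) \<partial>\<pi>) < ennreal (\<epsilon> + \<delta>)" by simp
  have int: "integrable \<pi> (\<lambda>p. l1_norm (fst p - snd p))"
  proof (rule integrableI_nonneg)
    show "(\<lambda>p. l1_norm (fst p - snd p)) \<in> borel_measurable \<pi>" by measurable
    show "(\<integral>\<^sup>+p. ennreal (l1_norm (fst p - snd p)) \<partial>\<pi>) < \<infinity>"
      using c by (rule less_trans) simp
  qed (simp add: l1_norm_nonneg)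
  moreover have "(\<integral>p. l1_norm (fst p - snd p) \<partial>\<pi>) \<le> \<epsilon> + \<delta>"
    using less_imp_le[OF c] nn_integral_eq_integral[OF int] assms(2,3)
    by (simp add: l1_norm_nonneg ennreal_le_iff del: ennreal_plus)
  ultimately show ?thesis using that \<pi> by blast
qed

text \<open>The pointwise bound is integrated against a nearly optimal coupling: the distance term
  contributes at most \<open>l * (\<epsilon> + \<delta>)\<close>, and the remaining term depends on
  the first coordinate only, hence is averaged over the data points.\<close>

lemma expectation_le_dual:
  fixes a :: "real ^ 'n::finite" and h :: "nat \<Rightarrow> real"
  assumes K: "K \<ge> 1" and S: "bounded S" "S \<in> sets borel"
    and Q: "Q \<in> ambiguity_set K S \<epsilon> C" and "\<epsilon> \<ge> 0" and l: "l \<ge> 0"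
    and bound: "\<And>k y. k \<in> {1..K} \<Longrightarrow> y \<in> S \<Longrightarrow> a \<bullet> y \<le> l * l1_norm (C k - y) + h k"
  shows "(\<integral>c. a \<bullet> c \<partial>Q) \<le> l * \<epsilon> + (\<Sum>k=1..K. h k) / real K"
proof (rule field_le_epsilon)
  fix e :: real assume "e > 0"
  \<comment> \<open>The denominator \<open>l + 1\<close> also covers \<open>l = 0\<close>.\<close>
  define \<delta> where "\<delta> = e / (l + 1)"
  have \<delta>: "\<delta> > 0" "l * \<delta> \<le> e"
    using \<open>e > 0\<close> l by (auto simp: \<delta>_def field_simps)
  obtain \<pi> where \<pi>: "\<pi> \<in> couplings S (empirical K C) Q"
    and intN: "integrable \<pi> (\<lambda>p. l1_norm (fst p - snd p))"
    and cost: "(\<integral>p. l1_norm (fst p - snd p) \<partial>\<pi>) \<le> \<epsilon> + \<delta>"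
    using exists_cheap_coupling[OF Q \<open>\<epsilon> \<ge> 0\<close> \<delta>(1) S(2)] .
  from \<pi> interpret prob_space \<pi> by (simp add: couplings_def)
  from \<pi> have [measurable_cong]: "sets \<pi> = sets (borel \<Otimes>\<^sub>M borel)"
    and fst: "distr \<pi> borel fst = empirical K C" and snd: "distr \<pi> borel snd = Q"
    by (auto simp: couplings_def)
  have AE_S: "AE p in \<pi>. p \<in> S \<times> S"
    using \<pi> S(2) by (intro AE_prob_1) (auto simp: couplings_def measure_def)
  \<comment> \<open>The first marginal does not see the index of an atom, so data points that coincide share the
    smallest of their bounds.\<close>
  define m where "m c = Min (h ` {k \<in> {1..K}. C k = c})" for c
  define \<phi> where "\<phi> c = (\<Sum>z\<in>C ` {1..K}. m z * indicator {z} c)" for c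
  have \<phi>_atom: "\<phi> (C k) = m (C k)" if "k \<in> {1..K}" for k
  proof -
    have "\<phi> (C k) = (\<Sum>z\<in>C ` {1..K}. if z = C k then m z else 0)"
      unfolding \<phi>_def by (intro sum.cong) (auto simp: indicator_def)
    then show ?thesis using that by simp
  qed
  have \<phi>_meas[measurable]: "\<phi> \<in> borel_measurable borel"
    unfolding \<phi>_def[abs_def] by measurable
  have AE_atom: "AE p in \<pi>. fst p \<in> C ` {1..K}"
  proof -
    have atoms: "C ` {1..K} \<in> sets borel"
      by (intro borel_closed finite_imp_closed) simp
    have "AE c in empirical K C. c \<in> C ` {1..K}"
      unfolding empirical_eq_distr[OF K] using K atoms
      by (subst AE_distr_iff) (auto simp: AE_measure_pmf_iff)
    then show ?thesis
      using atoms unfolding fst[symmetric] by (subst (asm) AE_distr_iff) auto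
  qed
  obtain M where M: "\<And>y. y \<in> S \<Longrightarrow> norm y \<le> M"
    using S(1) by (auto simp: bounded_iff)
  have intA: "integrable \<pi> (\<lambda>p. a \<bullet> snd p)"
  proof (rule integrable_const_bound[where B = "norm a * M"])
    show "AE p in \<pi>. norm (a \<bullet> snd p) \<le> norm a * M"
      using AE_S by eventually_elim
        (auto intro!: order_trans[OF Cauchy_Schwarz_ineq2] mult_left_mono M)
  qed measurable
  have int\<phi>: "integrable \<pi> (\<lambda>p. \<phi> (fst p))"
  proof (rule integrable_const_bound[where B = "\<Sum>z\<in>C ` {1..K}. \<bar>m z\<bar>"])
    show "AE p in \<pi>. norm (\<phi> (fst p)) \<le> (\<Sum>z\<in>C ` {1..K}. \<bar>m z\<bar>)"
      unfolding \<phi>_def real_norm_def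
      by (intro AE_I2 order_trans[OF sum_abs] sum_mono) (simp add: indicator_def)
  qed measurable
  have "(\<integral>c. a \<bullet> c \<partial>Q) = (\<integral>p. a \<bullet> snd p \<partial>\<pi>)"
    unfolding snd[symmetric] by (subst integral_distr) auto
  also have "\<dots> \<le> (\<integral>p. l * l1_norm (fst p - snd p) + \<phi> (fst p) \<partial>\<pi>)"
  proof (rule integral_mono_AE)
    show "AE p in \<pi>. a \<bullet> snd p \<le> l * l1_norm (fst p - snd p) + \<phi> (fst p)"
      using AE_S AE_atom
    proof eventually_elim
      fix p assume p: "p \<in> S \<times> S" "fst p \<in> C ` {1..K}"
      let ?I = "{k \<in> {1..K}. C k = fst p}"
      \<comment> \<open>The minimum is attained at an index whose data point is
        \<open>fst p\<close>, and the bound for that index is the one used.\<close>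
      have "m (fst p) \<in> h ` ?I"
        unfolding m_def using p(2) by (intro Min_in) auto
      then obtain k where k: "k \<in> {1..K}" "C k = fst p" "m (fst p) = h k" by auto
      then have "\<phi> (fst p) = h k" using \<phi>_atom[of k] by simp
      then show "a \<bullet> snd p \<le> l * l1_norm (fst p - snd p) + \<phi> (fst p)"
        using bound[of k "snd p"] k p(1) by (auto simp: mem_Times_iff)
    qed
  qed (use intA intN int\<phi> in auto)
  also have "\<dots> = l * (\<integral>p. l1_norm (fst p - snd p) \<partial>\<pi>) + (\<integral>p. \<phi> (fst p) \<partial>\<pi>)"
    using intN int\<phi> by simp
  also have "(\<integral>p. \<phi> (fst p) \<partial>\<pi>) = (\<integral>c. \<phi> c \<partial>empirical K C)"
    unfolding fst[symmetric] by (subst integral_distr) auto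
  also have "\<dots> = (\<Sum>k=1..K. m (C k)) / real K"
    using K by (simp add: integral_empirical \<phi>_atom)
  also have "\<dots> \<le> (\<Sum>k=1..K. h k) / real K"
    unfolding m_def by (intro divide_right_mono sum_mono Min_le) auto
  also have "l * (\<integral>p. l1_norm (fst p - snd p) \<partial>\<pi>) \<le> l * (\<epsilon> + \<delta>)"
    using cost l by (rule mult_left_mono)
  also have "\<dots> \<le> l * \<epsilon> + e" using \<delta> by (simp add: algebra_simps)
  finally show "(\<integral>c. a \<bullet> c \<partial>Q) \<le> l * \<epsilon> + (\<Sum>k=1..K. h k) / real K + e" by simp
qed

section \<open>Discrete distributions in the Wasserstein ball\<close>

lemma empirical_in_distributions_on:
  assumes "K \<ge> 1" and "\<And>k. k \<in> {1..K} \<Longrightarrow> q k \<in> S" and "S \<in> sets borel"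
  shows "empirical K q \<in> distributions_on S"
proof -
  have "emeasure (empirical K q) S = 1"
  proof -
    have "emeasure (empirical K q) S = emeasure (measure_pmf (pmf_of_set {1..K})) (q -` S)"
      using assms by (simp add: empirical_eq_distr emeasure_distr)
    also have "\<dots> = 1"
      using assms(1,2) by (intro measure_pmf.emeasure_eq_1_AE) (auto simp: AE_measure_pmf_iff)
    finally show ?thesis .
  qed
  moreover have "prob_space (empirical K q)"
    unfolding empirical_eq_distr[OF assms(1)] by (intro measure_pmf.prob_space_distr) auto
  ultimately show ?thesis by (simp add: distributions_on_def)
qed

text \<open>Drawing an index uniformly and pairing \<open>C k\<close> with \<open>q k\<close> is a
  coupling whose cost is the average distance, which bounds the infimum from above.\<close>

lemma empirical_in_ambiguity_set:
  assumes K: "K \<ge> 1" and S: "S \<in> sets borel"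
    and q: "\<And>k. k \<in> {1..K} \<Longrightarrow> q k \<in> S" and C: "\<And>k. k \<in> {1..K} \<Longrightarrow> C k \<in> S"
    and cost: "(\<Sum>k=1..K. l1_norm (C k - q k)) \<le> real K * \<epsilon>"
  shows "empirical K q \<in> ambiguity_set K S \<epsilon> C"
proof -
  let ?M = "measure_pmf (pmf_of_set {1..K})"
  define \<pi> where "\<pi> = distr ?M (borel \<Otimes>\<^sub>M borel) (\<lambda>k. (C k, q k))"
  have "emeasure \<pi> (S \<times> S) = emeasure ?M ((\<lambda>k. (C k, q k)) -` (S \<times> S))"
    unfolding \<pi>_def using S by (subst emeasure_distr) (auto simp: space_pair_measure)
  also have "\<dots> = 1"
    using K q C by (intro measure_pmf.emeasure_eq_1_AE) (auto simp: AE_measure_pmf_iff)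
  finally have "emeasure \<pi> (S \<times> S) = 1" .
  moreover have "prob_space \<pi>"
    unfolding \<pi>_def by (intro measure_pmf.prob_space_distr) (auto simp: space_pair_measure)
  moreover have "distr \<pi> borel fst = empirical K C" "distr \<pi> borel snd = empirical K q"
    unfolding \<pi>_def empirical_eq_distr[OF K] by (subst distr_distr; simp add: comp_def space_pair_measure)+
  ultimately have "\<pi> \<in> couplings S (empirical K C) (empirical K q)"
    by (simp add: couplings_def \<pi>_def)
  then have "wasserstein1 S (empirical K C) (empirical K q)
      \<le> (\<integral>\<^sup>+p\<in>S \<times> S. ennreal (l1_norm (fst p - snd p)) \<partial>\<pi>)"
    unfolding wasserstein1_def by (rule INF_lower)
  also have "\<dots> \<le> (\<integral>\<^sup>+p. ennreal (l1_norm (fst p - snd p)) \<partial>\<pi>)"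
    by (intro nn_integral_mono) (auto simp: indicator_def)
  also have "\<dots> = (\<integral>\<^sup>+k. ennreal (l1_norm (C k - q k)) \<partial>?M)"
    unfolding \<pi>_def by (subst nn_integral_distr) (auto simp: space_pair_measure)
  also have "\<dots> = ennreal ((\<Sum>k=1..K. l1_norm (C k - q k)) / real K)"
    using K by (subst nn_integral_pmf_of_set)
      (auto simp: sum_ennreal l1_norm_nonneg ennreal_of_nat_eq_real_of_nat divide_ennreal sum_nonneg)
  also have "\<dots> \<le> ennreal \<epsilon>"
    using cost K by (intro ennreal_leI) (simp add: divide_simps mult.commute)
  finally show ?thesis
    using empirical_in_distributions_on[of K q S] K q S by (simp add: ambiguity_set_def)
qed

section \<open>Linear programming duality for the discrete adversary\<close>

lemma lookup_scaleR:
  "Poly_Mapping.lookup (r *\<^sub>R v) k = r *\<^sub>R Poly_Mapping.lookup v k"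
proof -
  have "finite {i. r *\<^sub>R Poly_Mapping.lookup v i \<noteq> 0}"
    by (rule finite_subset[OF _ finite_lookup[of v]]) auto
  then show ?thesis by (simp add: scaleR_poly_mapping_def)
qed

text \<open>The last hypothesis bounds the value of a feasible finite linear program. The affine
  Farkas lemma turns this bound into multipliers, and comparing coefficients in the resulting
  identity of linear forms yields the dual constraints.\<close>

lemma lp_dual_attained:
  fixes a :: "real ^ 'n::finite" and w :: "nat \<Rightarrow> nat"
    and B :: "nat \<Rightarrow> nat \<Rightarrow> real ^ 'n" and b :: "nat \<Rightarrow> nat \<Rightarrow> real"
  defines "S \<equiv> \<lambda>k. ineq_set (w k) (B k) (b k)"
  assumes K: "K \<ge> 1" and ne: "\<And>k. k \<in> {1..K} \<Longrightarrow> S k \<noteq> {}"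
    and sub: "\<And>k. k \<in> {1..K} \<Longrightarrow> S k \<subseteq> S 0" and "\<epsilon> \<ge> 0"
    and bound: "\<And>q c. (\<And>k. k \<in> {1..K} \<Longrightarrow> q k \<in> S 0) \<Longrightarrow> (\<And>k. k \<in> {1..K} \<Longrightarrow> c k \<in> S k)
      \<Longrightarrow> (\<Sum>k=1..K. l1_norm (c k - q k)) \<le> real K * \<epsilon> \<Longrightarrow> (\<Sum>k=1..K. a \<bullet> q k) \<le> real K * \<beta>"
  obtains l \<nu> \<gamma> where "0 \<le> l"
    and "\<And>k. k \<in> {1..K} \<Longrightarrow>
      (1 / real K) *\<^sub>R (a - transpose_mult (w 0) (B 0) (\<nu> k)) = transpose_mult (w k) (B k) (\<gamma> k)"
    and "\<And>k i. k \<in> {1..K} \<Longrightarrow> \<bar>(a - transpose_mult (w 0) (B 0) (\<nu> k)) $ i\<bar> \<le> l"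
    and "\<And>k j. k \<in> {1..K} \<Longrightarrow> j < w 0 \<Longrightarrow> 0 \<le> \<nu> k j"
    and "\<And>k j. k \<in> {1..K} \<Longrightarrow> j < w k \<Longrightarrow> 0 \<le> \<gamma> k j"
    and "l * \<epsilon> + 1 / real K * (\<Sum>k=1..K. \<Sum>j<w 0. b 0 j * \<nu> k j)
      + (\<Sum>k=1..K. \<Sum>j<w k. b k j * \<gamma> k j) \<le> \<beta>"
proof -
  \<comment> \<open>The primal program has variables \<open>q k\<close> in the support set, \<open>c k\<close> in the data set and
    \<open>z k\<close> bounding the absolute values of the entries of \<open>c k - q k\<close>. Finitely supported functions
    serve as the \<open>K\<close>-fold power of the space of these triples, as \<open>K\<close> is not a type.\<close>
  define q :: "(nat \<Rightarrow>\<^sub>0 ((real ^ 'n) \<times> (real ^ 'n) \<times> (real ^ 'n))) \<Rightarrow> nat \<Rightarrow> real ^ 'n"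
    where "q v k = fst (Poly_Mapping.lookup v k)" for v k
  define c :: "(nat \<Rightarrow>\<^sub>0 ((real ^ 'n) \<times> (real ^ 'n) \<times> (real ^ 'n))) \<Rightarrow> nat \<Rightarrow> real ^ 'n"
    where "c v k = fst (snd (Poly_Mapping.lookup v k))" for v k
  define z :: "(nat \<Rightarrow>\<^sub>0 ((real ^ 'n) \<times> (real ^ 'n) \<times> (real ^ 'n))) \<Rightarrow> nat \<Rightarrow> real ^ 'n"
    where "z v k = snd (snd (Poly_Mapping.lookup v k))" for v k
  have add: "q (v + v') k = q v k + q v' k" "c (v + v') k = c v k + c v' k"
      "z (v + v') k = z v k + z v' k" for v v' k
    by (simp_all add: q_def c_def z_def lookup_add)
  have scale: "q (r *\<^sub>R v) k = r *\<^sub>R q v k" "c (r *\<^sub>R v) k = r *\<^sub>R c v k"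
      "z (r *\<^sub>R v) k = r *\<^sub>R z v k" for r v k
    by (simp_all add: q_def c_def z_def lookup_scaleR)
  \<comment> \<open>Five families of rows: membership of \<open>q k\<close> in the support set,
    membership of \<open>c k\<close> in its data set, the two signs of the absolute-value
    constraints, and the single transport budget.\<close>
  define J :: "((nat \<times> nat + nat \<times> nat) + ((nat \<times> 'n + nat \<times> 'n) + unit)) set" where
    "J = ((SIGMA k:{1..K}. {..<w 0}) <+> (SIGMA k:{1..K}. {..<w k}))
      <+> (((SIGMA k:{1..K}. UNIV) <+> (SIGMA k:{1..K}. UNIV)) <+> {()})"
  define f :: "(nat \<times> nat + nat \<times> nat) + ((nat \<times> 'n + nat \<times> 'n) + unit) \<Rightarrow> _" where
    "f = case_sum (case_sum (\<lambda>(k, j) v. B 0 j \<bullet> q v k) (\<lambda>(k, j) v. B k j \<bullet> c v k))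
      (case_sum (case_sum (\<lambda>(k, i) v. q v k $ i - c v k $ i - z v k $ i)
          (\<lambda>(k, i) v. c v k $ i - q v k $ i - z v k $ i))
        (\<lambda>_ v. \<Sum>k=1..K. \<Sum>i\<in>UNIV. z v k $ i))"
  define d :: "(nat \<times> nat + nat \<times> nat) + ((nat \<times> 'n + nat \<times> 'n) + unit) \<Rightarrow> real" where
    "d = case_sum (case_sum (\<lambda>(k, j). b 0 j) (\<lambda>(k, j). b k j))
      (case_sum (case_sum (\<lambda>_. 0) (\<lambda>_. 0)) (\<lambda>_. real K * \<epsilon>))"
  define g where "g v = (\<Sum>k=1..K. a \<bullet> q v k)" for v
  define c0 where "c0 k = (SOME y. y \<in> S k)" for k
  have c0: "c0 k \<in> S k" if "k \<in> {1..K}" for k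
    using ne[OF that] by (simp add: c0_def some_in_eq)
  \<comment> \<open>A feasible point: nothing is moved, so \<open>q = c\<close> and
    \<open>z = 0\<close>; it uses that each data set lies in the support set.\<close>
  define v0 where "v0 = (\<Sum>k\<in>{1..K}. Poly_Mapping.single k (c0 k, c0 k, 0 :: real ^ 'n))"
  have lookup_v0: "Poly_Mapping.lookup v0 k = (c0 k, c0 k, 0)" if "k \<in> {1..K}" for k
    using that by (simp add: v0_def lookup_sum lookup_single when_def)
  have "\<exists>u. (\<forall>j\<in>J. 0 \<le> u j) \<and> (\<forall>v. g v = (\<Sum>j\<in>J. u j * f j v)) \<and> (\<Sum>j\<in>J. u j * d j) \<le> real K * \<beta>"
  proof (rule farkas_affine)
    show "finite J" by (simp add: J_def)
    show "linear (f j)" for j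
      by (intro linearI) (auto simp: f_def add scale inner_add_right algebra_simps sum.distrib
          sum_distrib_left split: sum.split)
    show "linear g"
      unfolding g_def by (intro linearI)
        (auto simp: add scale inner_add_right sum.distrib sum_distrib_left)
    show "f j v0 \<le> d j" if "j \<in> J" for j
      using that c0 sub \<open>\<epsilon> \<ge> 0\<close>
      by (fastforce simp: J_def f_def d_def q_def c_def z_def lookup_v0 S_def ineq_set_def)
  next
    fix v assume v: "\<And>j. j \<in> J \<Longrightarrow> f j v \<le> d j"
    have vq: "B 0 j \<bullet> q v k \<le> b 0 j" if "k \<in> {1..K}" "j < w 0" for k j
      using v[of "Inl (Inl (k, j))"] that by (simp add: J_def f_def d_def InlI InrI)
    have vc: "B k j \<bullet> c v k \<le> b k j" if "k \<in> {1..K}" "j < w k" for k j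
      using v[of "Inl (Inr (k, j))"] that by (simp add: J_def f_def d_def InlI InrI)
    have vz: "\<bar>c v k $ i - q v k $ i\<bar> \<le> z v k $ i" if "k \<in> {1..K}" for k i
      using v[of "Inr (Inl (Inl (k, i)))"] v[of "Inr (Inl (Inr (k, i)))"] that
      by (simp add: J_def f_def d_def InlI InrI abs_le_iff)
    have vb: "(\<Sum>k=1..K. \<Sum>i\<in>UNIV. z v k $ i) \<le> real K * \<epsilon>"
      using v[of "Inr (Inr ())"] by (simp add: J_def f_def d_def InlI InrI)
    have "(\<Sum>k=1..K. l1_norm (c v k - q v k)) \<le> (\<Sum>k=1..K. \<Sum>i\<in>UNIV. z v k $ i)"
      unfolding l1_norm_def by (intro sum_mono) (simp add: vz)
    then show "g v \<le> real K * \<beta>"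
      unfolding g_def using vq vc vb
      by (intro bound[of "q v" "c v"]) (auto simp: S_def ineq_set_def)
  qed
  then obtain u where u: "\<And>j. j \<in> J \<Longrightarrow> 0 \<le> u j"
    and gu: "\<And>v. g v = (\<Sum>j\<in>J. u j * f j v)" and du: "(\<Sum>j\<in>J. u j * d j) \<le> real K * \<beta>"
    by blast
  define \<nu> where "\<nu> k j = u (Inl (Inl (k, j)))" for k j
  define \<eta> where "\<eta> k j = u (Inl (Inr (k, j)))" for k j
  define p where "p k i = u (Inr (Inl (Inl (k, i))))" for k i
  define n where "n k i = u (Inr (Inl (Inr (k, i))))" for k i
  define l where "l = u (Inr (Inr ()))"
  have u_nonneg: "0 \<le> l"
    "k \<in> {1..K} \<Longrightarrow> j < w 0 \<Longrightarrow> 0 \<le> \<nu> k j" "k \<in> {1..K} \<Longrightarrow> j' < w k \<Longrightarrow> 0 \<le> \<eta> k j'"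
    "k \<in> {1..K} \<Longrightarrow> 0 \<le> p k i" "k \<in> {1..K} \<Longrightarrow> 0 \<le> n k i" for k j j' i
    using u by (simp_all add: l_def \<nu>_def \<eta>_def p_def n_def J_def InlI InrI)
  have sum_J: "(\<Sum>j\<in>J. u j * h j) =
      (\<Sum>k=1..K. \<Sum>j<w 0. \<nu> k j * h (Inl (Inl (k, j))))
      + (\<Sum>k=1..K. \<Sum>j<w k. \<eta> k j * h (Inl (Inr (k, j))))
      + (\<Sum>k=1..K. \<Sum>i\<in>UNIV. p k i * h (Inr (Inl (Inl (k, i)))))
      + (\<Sum>k=1..K. \<Sum>i\<in>UNIV. n k i * h (Inr (Inl (Inr (k, i)))))
      + l * h (Inr (Inr ()))" for h
    by (simp add: J_def sum.Plus sum.Sigma \<nu>_def \<eta>_def p_def n_def l_def split_def)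
  \<comment> \<open>The share of index \<open>k\<close> in the difference between \<open>g\<close>
    and the weighted constraints, as a linear form in the triple at \<open>k\<close>.\<close>
  define D where "D k y = (case y of (q, c, z) \<Rightarrow>
      a \<bullet> q - transpose_mult (w 0) (B 0) (\<nu> k) \<bullet> q - transpose_mult (w k) (B k) (\<eta> k) \<bullet> c
      - (\<Sum>i\<in>UNIV. p k i * (q $ i - c $ i - z $ i)) - (\<Sum>i\<in>UNIV. n k i * (c $ i - q $ i - z $ i))
      - l * (\<Sum>i\<in>UNIV. z $ i))" for k and y :: "(real ^ 'n) \<times> (real ^ 'n) \<times> (real ^ 'n)"
  have sum_D: "(\<Sum>k=1..K. D k (Poly_Mapping.lookup v k)) = 0" for v
  proof -
    have "D k (Poly_Mapping.lookup v k) = a \<bullet> q v k - (\<Sum>j<w 0. \<nu> k j * (B 0 j \<bullet> q v k))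
        - (\<Sum>j<w k. \<eta> k j * (B k j \<bullet> c v k))
        - (\<Sum>i\<in>UNIV. p k i * (q v k $ i - c v k $ i - z v k $ i))
        - (\<Sum>i\<in>UNIV. n k i * (c v k $ i - q v k $ i - z v k $ i))
        - l * (\<Sum>i\<in>UNIV. z v k $ i)" for k
      by (simp add: D_def q_def c_def z_def split_def transpose_mult_def inner_sum_left)
    then show ?thesis
      using gu[of v] by (simp add: sum_J g_def f_def sum_subtractf sum_distrib_left)
  qed
  \<comment> \<open>A function supported at the single index \<open>k\<close> isolates one
    summand.\<close>
  have D: "D k y = 0" if "k \<in> {1..K}" for k y
  proof -
    have "D k' (Poly_Mapping.lookup (Poly_Mapping.single k y) k') = (if k' = k then D k y else 0)" for k'
      by (auto simp: lookup_single when_def D_def zero_prod_def)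
    then show ?thesis using sum_D[of "Poly_Mapping.single k y"] that by simp
  qed
  have axis: "(\<Sum>i\<in>UNIV. h i * (axis i0 1 $ i)) = h i0" for h :: "'n \<Rightarrow> real" and i0
    by (simp add: axis_def if_distrib cong: if_cong)
  have axis1: "(\<Sum>i\<in>UNIV. (axis i0 1 :: real ^ 'n) $ i) = 1" for i0
    using axis[of "\<lambda>_. 1"] by simp
  \<comment> \<open>Unit vectors in the three slots of the triple read off the coefficients of
    \<open>q\<close>, \<open>c\<close> and \<open>z\<close>.\<close>
  have Dq: "(a - transpose_mult (w 0) (B 0) (\<nu> k)) $ i = p k i - n k i" if "k \<in> {1..K}" for k i
    using D[OF that, of "(axis i 1, 0, 0)"] by (simp add: D_def inner_axis sum_negf axis)
  have Dc: "transpose_mult (w k) (B k) (\<eta> k) $ i = p k i - n k i" if "k \<in> {1..K}" for k i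
    using D[OF that, of "(0, axis i 1, 0)"] by (simp add: D_def inner_axis sum_negf axis)
  have Dz: "p k i + n k i = l" if "k \<in> {1..K}" for k i
    using D[OF that, of "(0, 0, axis i 1)"] by (simp add: D_def sum_negf axis axis1)
  \<comment> \<open>The Farkas identity concerns the sum over \<open>k\<close>, the target program
    the average; among the multipliers only \<open>\<eta>\<close> has to absorb the factor
    \<open>1 / K\<close>.\<close>
  define \<gamma> where "\<gamma> k j = \<eta> k j / real K" for k j
  show thesis
  proof (rule that[of l \<nu> \<gamma>])
    show "0 \<le> l" by (rule u_nonneg)
    show "(1 / real K) *\<^sub>R (a - transpose_mult (w 0) (B 0) (\<nu> k)) = transpose_mult (w k) (B k) (\<gamma> k)"
      if "k \<in> {1..K}" for k
    proof -
      have "a - transpose_mult (w 0) (B 0) (\<nu> k) = transpose_mult (w k) (B k) (\<eta> k)"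
        using Dq[OF that] Dc[OF that] by (simp add: vec_eq_iff)
      then show ?thesis
        by (simp add: transpose_mult_def \<gamma>_def scaleR_sum_right)
    qed
    show "\<bar>(a - transpose_mult (w 0) (B 0) (\<nu> k)) $ i\<bar> \<le> l" if "k \<in> {1..K}" for k i
      \<comment> \<open>For nonnegative \<open>p\<close> and \<open>n\<close> one has
        \<open>\<bar>p - n\<bar> \<le> p + n\<close>, and the right-hand side is
        \<open>l\<close>.\<close>
      using Dz[OF that, of i] u_nonneg(4,5)[OF that, of i] unfolding Dq[OF that] by linarith
    show "0 \<le> \<nu> k j" if "k \<in> {1..K}" "j < w 0" for k j using that by (rule u_nonneg)
    show "0 \<le> \<gamma> k j" if "k \<in> {1..K}" "j < w k" for k j
      using u_nonneg(3)[OF that] by (simp add: \<gamma>_def)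
    have "(\<Sum>k=1..K. \<Sum>j<w 0. \<nu> k j * b 0 j) + (\<Sum>k=1..K. \<Sum>j<w k. \<eta> k j * b k j)
        + l * (real K * \<epsilon>) \<le> real K * \<beta>"
      using du by (simp add: sum_J d_def)
    moreover have "real K * (\<Sum>k=1..K. \<Sum>j<w k. b k j * \<gamma> k j) = (\<Sum>k=1..K. \<Sum>j<w k. \<eta> k j * b k j)"
      using K by (simp add: sum_distrib_left \<gamma>_def mult.commute)
    ultimately have "real K * (l * \<epsilon> + 1 / real K * (\<Sum>k=1..K. \<Sum>j<w 0. b 0 j * \<nu> k j)
        + (\<Sum>k=1..K. \<Sum>j<w k. b k j * \<gamma> k j)) \<le> real K * \<beta>"
      using K by (simp add: algebra_simps)
    then show "l * \<epsilon> + 1 / real K * (\<Sum>k=1..K. \<Sum>j<w 0. b 0 j * \<nu> k j)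
        + (\<Sum>k=1..K. \<Sum>j<w k. b k j * \<gamma> k j) \<le> \<beta>"
      using K by (simp add: mult_le_cancel_left)
  qed
qed

section \<open>Polyhedra, the l1-norm and the expected loss\<close>

lemma closed_ineq_set: "closed (ineq_set w B b)"
proof -
  have "ineq_set w B b = (\<Inter>j\<in>{..<w}. {c. B j \<bullet> c \<le> b j})"
    by (auto simp: ineq_set_def)
  then show ?thesis by (auto intro!: closed_INT closed_halfspace_le)
qed

lemma transpose_mult_inner_le:
  assumes "c \<in> ineq_set w B b" and "\<And>j. j < w \<Longrightarrow> 0 \<le> u j"
  shows "transpose_mult w B u \<bullet> c \<le> (\<Sum>j<w. b j * u j)"
  unfolding transpose_mult_def inner_sum_left
proof (rule sum_mono)
  fix j assume "j \<in> {..<w}"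
  then have "B j \<bullet> c \<le> b j" "0 \<le> u j" using assms by (auto simp: ineq_set_def)
  then have "u j * (B j \<bullet> c) \<le> u j * b j" by (rule mult_left_mono)
  then show "(u j *\<^sub>R B j) \<bullet> c \<le> b j * u j" by (simp add: mult.commute)
qed

text \<open>Hoelder's inequality for the maximum norm and the l1-norm.\<close>

lemma inner_le_l1_norm:
  assumes "\<And>i. \<bar>u $ i\<bar> \<le> l"
  shows "u \<bullet> y \<le> l * l1_norm (y :: real ^ 'n::finite)"
  unfolding inner_vec_def l1_norm_def sum_distrib_left
proof (rule sum_mono)
  fix i
  have "u $ i * y $ i \<le> \<bar>u $ i\<bar> * \<bar>y $ i\<bar>" by (metis abs_ge_self abs_mult)
  also have "\<dots> \<le> l * \<bar>y $ i\<bar>" using assms by (rule mult_right_mono) simp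
  finally show "u $ i \<bullet> y $ i \<le> l * \<bar>y $ i\<bar>" by simp
qed

lemma loss_eq: "loss T t1 t2 t0 x c = (T *v x + t2) \<bullet> c + (t1 \<bullet> x + t0)"
  by (simp add: loss_def inner_add_left inner_add_right inner_commute)

text \<open>Splitting off the constant requires the linear part to be integrable; it is bounded
  almost everywhere because the bounded set \<open>S\<close> carries \<open>Q\<close>.\<close>

lemma integral_loss:
  assumes Q: "Q \<in> distributions_on S" and S: "bounded S" "S \<in> sets borel"
  shows "(\<integral>c. loss T t1 t2 t0 x c \<partial>Q) = (\<integral>c. (T *v x + t2) \<bullet> c \<partial>Q) + (t1 \<bullet> x + t0)"
proof -
  from Q interpret prob_space Q by (simp add: distributions_on_def)
  from Q have [measurable_cong]: "sets Q = sets borel" by (simp add: distributions_on_def)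
  have AE_S: "AE c in Q. c \<in> S"
    using Q S(2) by (intro AE_prob_1) (auto simp: distributions_on_def measure_def)
  obtain M where M: "\<And>y. y \<in> S \<Longrightarrow> norm y \<le> M"
    using S(1) by (auto simp: bounded_iff)
  have "integrable Q (\<lambda>c. (T *v x + t2) \<bullet> c)"
  proof (rule integrable_const_bound[where B = "norm (T *v x + t2) * M"])
    show "AE c in Q. norm ((T *v x + t2) \<bullet> c) \<le> norm (T *v x + t2) * M"
      using AE_S by eventually_elim
        (auto intro!: order_trans[OF Cauchy_Schwarz_ineq2] mult_left_mono M)
  qed measurable
  then show ?thesis by (simp add: loss_eq prob_space)
qed

section \<open>Duality for a fixed decision\<close>

text \<open>Let \<open>r\<close> be the residual \<open>a\<close> minus the
  \<open>\<nu> k\<close>-combination of the support rows. Then \<open>a \<bullet> y\<close> splits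
  into that combination at \<open>y\<close>, \<open>r \<bullet> (y - C k)\<close> and
  \<open>r \<bullet> C k\<close>. These are bounded by nonnegativity of \<open>\<nu>\<close>, by the
  box constraint on \<open>r\<close>, and by writing \<open>r\<close> as \<open>K\<close> times the
  \<open>\<gamma> k\<close>-combination of the data rows.\<close>

lemma weak_duality:
  fixes S :: "nat \<Rightarrow> (real ^ 'n::finite) set"
  assumes K: "K \<ge> 1" and S: "\<And>k. S k = ineq_set (w k) (B k) (b k)" and bdd: "bounded (S 0)"
    and "\<epsilon> \<ge> 0"
    and feas: "(x, l, \<nu>, \<gamma>) \<in> milp_feasible K X w B T t2"
  shows "worst_case_expectation K S \<epsilon> (loss T t1 t2 t0 x)
    \<le> ereal (milp_objective K \<epsilon> w b t1 t0 (x, l, \<nu>, \<gamma>))"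
  unfolding worst_case_expectation_def
proof (intro SUP_least, clarsimp)
  fix C Q assume C: "\<forall>k\<in>{Suc 0..K}. C k \<in> S k" and Q: "Q \<in> ambiguity_set K (S 0) \<epsilon> C"
  have meas: "S 0 \<in> sets borel" unfolding S by (intro borel_closed closed_ineq_set)
  define a where "a = T *v x + t2"
  \<comment> \<open>The factor \<open>real K\<close> cancels the division by \<open>real K\<close>
    in the average.\<close>
  define h where "h k = (\<Sum>j<w 0. b 0 j * \<nu> k j) + real K * (\<Sum>j<w k. b k j * \<gamma> k j)" for k
  have "(\<integral>c. a \<bullet> c \<partial>Q) \<le> l * \<epsilon> + (\<Sum>k=1..K. h k) / real K"
  proof (rule expectation_le_dual[OF K bdd meas Q \<open>\<epsilon> \<ge> 0\<close>])
    show "l \<ge> 0" using feas by (simp add: milp_feasible_def)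
    fix k y assume k: "k \<in> {1..K}" and y: "y \<in> S 0"
    define r where "r = a - transpose_mult (w 0) (B 0) (\<nu> k)"
    have r_eq: "r = real K *\<^sub>R transpose_mult (w k) (B k) (\<gamma> k)"
    proof -
      have "(1 / real K) *\<^sub>R r = transpose_mult (w k) (B k) (\<gamma> k)"
        using feas k by (simp add: milp_feasible_def r_def a_def)
      then have "real K *\<^sub>R ((1 / real K) *\<^sub>R r) = real K *\<^sub>R transpose_mult (w k) (B k) (\<gamma> k)"
        by simp
      then show ?thesis using K by simp
    qed
    have "- (l *\<^sub>R 1) \<le> r" "r \<le> l *\<^sub>R 1"
      using feas k by (auto simp: milp_feasible_def r_def a_def)
    then have "\<bar>r $ i\<bar> \<le> l" for i
      by (simp add: less_eq_vec_def abs_le_iff minus_le_iff)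
    then have r_l1: "r \<bullet> (y - C k) \<le> l * l1_norm (C k - y)"
      using inner_le_l1_norm[of "- r" l "C k - y"] by (simp add: inner_diff_right)
    have "transpose_mult (w k) (B k) (\<gamma> k) \<bullet> C k \<le> (\<Sum>j<w k. b k j * \<gamma> k j)"
      using feas k C by (intro transpose_mult_inner_le) (auto simp: S milp_feasible_def)
    then have "r \<bullet> C k \<le> real K * (\<Sum>j<w k. b k j * \<gamma> k j)"
      unfolding r_eq by (simp add: mult_left_mono)
    moreover have "transpose_mult (w 0) (B 0) (\<nu> k) \<bullet> y \<le> (\<Sum>j<w 0. b 0 j * \<nu> k j)"
      using feas k y by (intro transpose_mult_inner_le) (auto simp: S milp_feasible_def)
    moreover have "a \<bullet> y = transpose_mult (w 0) (B 0) (\<nu> k) \<bullet> y + r \<bullet> (y - C k) + r \<bullet> C k"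
      by (simp add: r_def inner_diff_left inner_diff_right)
    ultimately show "a \<bullet> y \<le> l * l1_norm (C k - y) + h k"
      using r_l1 by (simp add: h_def)
  qed
  also have "(\<Sum>k=1..K. h k) / real K = 1 / real K * (\<Sum>k=1..K. \<Sum>j<w 0. b 0 j * \<nu> k j)
      + (\<Sum>k=1..K. \<Sum>j<w k. b k j * \<gamma> k j)"
    using K by (simp add: h_def sum.distrib sum_distrib_left[symmetric] add_divide_distrib)
  finally show "(\<integral>c. loss T t1 t2 t0 x c \<partial>Q) \<le> milp_objective K \<epsilon> w b t1 t0 (x, l, \<nu>, \<gamma>)"
    using Q integral_loss[OF _ bdd meas]
    by (simp add: milp_objective_def ambiguity_set_def a_def)
qed

text \<open>The discrete adversary's supremum \<open>\<beta>\<close>, shifted by the constant part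
  of the loss, lies below the worst-case expectation, and some dual point has objective at most this
  shifted value. Weak duality at that same point closes the chain.\<close>

lemma strong_duality:
  fixes S :: "nat \<Rightarrow> (real ^ 'n::finite) set"
  assumes K: "K \<ge> 1" and S: "\<And>k. S k = ineq_set (w k) (B k) (b k)" and bdd: "bounded (S 0)"
    and ne: "\<And>k. k \<in> {1..K} \<Longrightarrow> S k \<noteq> {}" and sub: "\<And>k. k \<in> {1..K} \<Longrightarrow> S k \<subseteq> S 0"
    and "\<epsilon> \<ge> 0" and x: "x \<in> X"
  obtains l \<nu> \<gamma> where "(x, l, \<nu>, \<gamma>) \<in> milp_feasible K X w B T t2"
    and "ereal (milp_objective K \<epsilon> w b t1 t0 (x, l, \<nu>, \<gamma>))
      = worst_case_expectation K S \<epsilon> (loss T t1 t2 t0 x)"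
proof -
  have meas: "S 0 \<in> sets borel" unfolding S by (intro borel_closed closed_ineq_set)
  define a where "a = T *v x + t2"
  define P where "P = {(q, c). (\<forall>k\<in>{1..K}. q k \<in> S 0) \<and> (\<forall>k\<in>{1..K}. c k \<in> S k)
    \<and> (\<Sum>k=1..K. l1_norm (c k - q k)) \<le> real K * \<epsilon>}"
  define val where "val q = (\<Sum>k=1..K. a \<bullet> q k) / real K" for q :: "nat \<Rightarrow> real ^ 'n"
  \<comment> \<open>A supremum of reals, meaningful because \<open>P\<close> is nonempty and the
    bounded support set bounds \<open>val\<close> on it.\<close>
  define \<beta> where "\<beta> = (SUP (q, c)\<in>P. val q)"
  obtain M where M: "\<And>y. y \<in> S 0 \<Longrightarrow> norm y \<le> M"
    using bdd by (auto simp: bounded_iff)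
  have bddP: "bdd_above ((\<lambda>(q, c). val q) ` P)"
  proof (rule bdd_aboveI2[where M = "(\<Sum>k=1..K. norm a * M) / real K"], clarify)
    fix q c assume "(q, c) \<in> P"
    then show "val q \<le> (\<Sum>k=1..K. norm a * M) / real K"
      unfolding val_def P_def
      by (intro divide_right_mono sum_mono)
        (auto intro!: order_trans[OF norm_cauchy_schwarz] mult_left_mono M)
  qed
  have P_ne: "P \<noteq> {}"
  proof -
    define c0 where "c0 k = (SOME y. y \<in> S k)" for k
    have "c0 k \<in> S k" if "k \<in> {1..K}" for k using ne[OF that] by (simp add: c0_def some_in_eq)
    then have "(c0, c0) \<in> P" using sub \<open>\<epsilon> \<ge> 0\<close> by (fastforce simp: P_def l1_norm_def)
    then show ?thesis by blast
  qed
  have val_le: "ereal (val q + (t1 \<bullet> x + t0)) \<le> worst_case_expectation K S \<epsilon> (loss T t1 t2 t0 x)"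
    if "(q, c) \<in> P" for q c
  proof -
    have q: "\<And>k. k \<in> {1..K} \<Longrightarrow> q k \<in> S 0" and c: "\<And>k. k \<in> {1..K} \<Longrightarrow> c k \<in> S k"
      using that by (auto simp: P_def)
    have Q: "empirical K q \<in> ambiguity_set K (S 0) \<epsilon> c"
      using that sub by (intro empirical_in_ambiguity_set[OF K meas]) (fastforce simp: P_def)+
    then have "(\<integral>y. loss T t1 t2 t0 x y \<partial>empirical K q) = val q + (t1 \<bullet> x + t0)"
      using integral_loss[OF _ bdd meas, of "empirical K q"] K
      by (simp add: ambiguity_set_def val_def a_def integral_empirical)
    then show ?thesis
      unfolding worst_case_expectation_def
      using c Q by (intro SUP_upper2[of c] SUP_upper2[of "empirical K q"]) auto
  qed
  have wce_ge: "ereal (\<beta> + (t1 \<bullet> x + t0)) \<le> worst_case_expectation K S \<epsilon> (loss T t1 t2 t0 x)"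
    (is "_ \<le> ?W")
  \<comment> \<open>Finiteness of the worst-case expectation is not known yet, so the extended real
    is split into cases; a point of \<open>P\<close> rules out minus infinity.\<close>
  proof (cases ?W)
    case (real r)
    have "\<beta> \<le> r - (t1 \<bullet> x + t0)"
      unfolding \<beta>_def using P_ne val_le by (intro cSUP_least) (auto simp: real le_diff_eq)
    then show ?thesis by (simp add: real)
  next
    case MInf
    obtain q c where "(q, c) \<in> P" using P_ne by auto
    from val_le[OF this] show ?thesis by (simp add: MInf)
  qed simp
  obtain l \<nu> \<gamma> where l: "0 \<le> l"
    and eq: "\<And>k. k \<in> {1..K} \<Longrightarrow>
      (1 / real K) *\<^sub>R (a - transpose_mult (w 0) (B 0) (\<nu> k)) = transpose_mult (w k) (B k) (\<gamma> k)"
    and box: "\<And>k i. k \<in> {1..K} \<Longrightarrow> \<bar>(a - transpose_mult (w 0) (B 0) (\<nu> k)) $ i\<bar> \<le> l"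
    and pos: "\<And>k j. k \<in> {1..K} \<Longrightarrow> j < w 0 \<Longrightarrow> 0 \<le> \<nu> k j"
      "\<And>k j. k \<in> {1..K} \<Longrightarrow> j < w k \<Longrightarrow> 0 \<le> \<gamma> k j"
    and obj: "l * \<epsilon> + 1 / real K * (\<Sum>k=1..K. \<Sum>j<w 0. b 0 j * \<nu> k j)
      + (\<Sum>k=1..K. \<Sum>j<w k. b k j * \<gamma> k j) \<le> \<beta>"
  proof (rule lp_dual_attained[of K w B b \<epsilon> a \<beta>, folded S])
    fix q c assume "\<And>k. k \<in> {1..K} \<Longrightarrow> q k \<in> S 0" "\<And>k. k \<in> {1..K} \<Longrightarrow> c k \<in> S k"
      "(\<Sum>k=1..K. l1_norm (c k - q k)) \<le> real K * \<epsilon>"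
    then have "(q, c) \<in> P" by (simp add: P_def)
    then have "val q \<le> \<beta>"
      unfolding \<beta>_def using cSUP_upper[OF _ bddP] by fastforce
    then show "(\<Sum>k=1..K. a \<bullet> q k) \<le> real K * \<beta>"
      using K by (simp add: val_def divide_simps mult.commute)
  qed (use K ne sub \<open>\<epsilon> \<ge> 0\<close> in auto)
  define R where "R k = a - transpose_mult (w 0) (B 0) (\<nu> k)" for k
  have R_box: "- (l *\<^sub>R 1) \<le> R k" "R k \<le> l *\<^sub>R 1" if "k \<in> {1..K}" for k
    using box[OF that] unfolding R_def[symmetric]
    by (auto simp: less_eq_vec_def abs_le_iff minus_le_iff)
  have feas: "(x, l, \<nu>, \<gamma>) \<in> milp_feasible K X w B T t2"
    using l eq R_box pos x by (auto simp: milp_feasible_def R_def a_def)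
  moreover have "ereal (milp_objective K \<epsilon> w b t1 t0 (x, l, \<nu>, \<gamma>))
      \<le> worst_case_expectation K S \<epsilon> (loss T t1 t2 t0 x)"
    by (rule order_trans[OF _ wce_ge]) (use obj in \<open>simp add: milp_objective_def\<close>)
  ultimately show thesis
    using weak_duality[OF K S bdd \<open>\<epsilon> \<ge> 0\<close> feas] by (intro that) (auto intro: antisym)
qed

section \<open>From fixed decisions to the two minimization problems\<close>

theorem theorem1:
  fixes K :: nat
    and J :: "'n::finite set"
    and G :: "real ^ 'n ^ 'm::finite" and g :: "real ^ 'm"
    and T :: "real ^ 'n ^ 'n" and t1 t2 :: "real ^ 'n" and t0 :: real
    and w :: "nat \<Rightarrow> nat" and B :: "nat \<Rightarrow> nat \<Rightarrow> real ^ 'n" and b :: "nat \<Rightarrow> nat \<Rightarrow> real"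
    and \<epsilon> :: real
    and X :: "(real ^ 'n) set" and S :: "nat \<Rightarrow> (real ^ 'n) set"
  assumes "K \<ge> 1"
    and "J \<noteq> {}"
    and X_eq: "X = feasible_decisions J G g"
    and "transpose T = T"
    and S_eq: "\<And>k. S k = ineq_set (w k) (B k) (b k)"
    and "\<And>k. k \<in> {0..K} \<Longrightarrow> w k \<ge> 1"
    and "S 0 \<noteq> {}" and "bounded (S 0)"
    and "\<And>k. k \<in> {1..K} \<Longrightarrow> S k \<noteq> {}"
    and "\<And>k. k \<in> {1..K} \<Longrightarrow> S k \<subseteq> S 0"
    and "\<epsilon> > 0"
  shows "(INF x\<in>X. worst_case_expectation K S \<epsilon> (loss T t1 t2 t0 x))
           = (INF z\<in>milp_feasible K X w B T t2. ereal (milp_objective K \<epsilon> w b t1 t0 z))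
       \<and> (\<forall>x\<in>X.
            is_arg_min (\<lambda>x. worst_case_expectation K S \<epsilon> (loss T t1 t2 t0 x)) (\<lambda>x. x \<in> X) x
            \<longleftrightarrow> (\<exists>l \<nu> \<gamma>. is_arg_min (milp_objective K \<epsilon> w b t1 t0)
                   (\<lambda>z. z \<in> milp_feasible K X w B T t2) (x, l, \<nu>, \<gamma>)))"
proof -
  define V where "V x = worst_case_expectation K S \<epsilon> (loss T t1 t2 t0 x)" for x
  define F where "F = milp_feasible K X w B T t2"
  define obj where "obj = milp_objective K \<epsilon> w b t1 t0"
  have weak: "V (fst z) \<le> ereal (obj z)" and fst_F: "fst z \<in> X" if "z \<in> F" for z
  proof -
    obtain x l \<nu> \<gamma> where z: "z = (x, l, \<nu>, \<gamma>)" by (cases z)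
    show "V (fst z) \<le> ereal (obj z)"
      using weak_duality[of K S w B b \<epsilon> x l \<nu> \<gamma> X T t2 t1 t0] assms that
      by (simp add: V_def F_def obj_def z)
    show "fst z \<in> X" using that by (simp add: F_def milp_feasible_def z)
  qed
  \<comment> \<open>Some dual point attains \<open>V x\<close>, which in particular makes
    \<open>V x\<close> finite on \<open>X\<close>.\<close>
  have strong: "\<exists>l \<nu> \<gamma>. (x, l, \<nu>, \<gamma>) \<in> F \<and> ereal (obj (x, l, \<nu>, \<gamma>)) = V x" if "x \<in> X" for x
  proof (rule strong_duality[of K S w B b \<epsilon> x X T t2 t1 t0])
    fix l \<nu> \<gamma>
    assume "(x, l, \<nu>, \<gamma>) \<in> milp_feasible K X w B T t2"
      and "ereal (milp_objective K \<epsilon> w b t1 t0 (x, l, \<nu>, \<gamma>))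
        = worst_case_expectation K S \<epsilon> (loss T t1 t2 t0 x)"
    then show ?thesis unfolding V_def F_def obj_def by blast
  qed (use assms that in auto)
  have "(INF x\<in>X. V x) = (INF z\<in>F. ereal (obj z))"
  proof (rule antisym)
    show "(INF x\<in>X. V x) \<le> (INF z\<in>F. ereal (obj z))"
      using weak fst_F by (intro INF_greatest INF_lower2)
    show "(INF z\<in>F. ereal (obj z)) \<le> (INF x\<in>X. V x)"
    proof (rule INF_greatest)
      fix x assume "x \<in> X"
      from strong[OF this] obtain l \<nu> \<gamma>
        where "(x, l, \<nu>, \<gamma>) \<in> F" "ereal (obj (x, l, \<nu>, \<gamma>)) = V x" by blast
      then show "(INF z\<in>F. ereal (obj z)) \<le> V x" by (intro INF_lower2[of "(x, l, \<nu>, \<gamma>)"]) simp_all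
    qed
  qed
  moreover have "is_arg_min V (\<lambda>x. x \<in> X) x
      \<longleftrightarrow> (\<exists>l \<nu> \<gamma>. is_arg_min obj (\<lambda>z. z \<in> F) (x, l, \<nu>, \<gamma>))" if x: "x \<in> X" for x
  proof
    assume min: "is_arg_min V (\<lambda>x. x \<in> X) x"
    obtain l \<nu> \<gamma> where z: "(x, l, \<nu>, \<gamma>) \<in> F" "ereal (obj (x, l, \<nu>, \<gamma>)) = V x"
      using strong[OF x] by blast
    \<comment> \<open>The point over \<open>x\<close> that attains \<open>V x\<close> is globally
      optimal, since every \<open>z\<close> costs at least the value of its own decision.\<close>
    have "obj (x, l, \<nu>, \<gamma>) \<le> obj z" if "z \<in> F" for z
    proof -
      have "V x \<le> V (fst z)" using min fst_F[OF that] by (auto simp: is_arg_min_linorder)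
      also have "\<dots> \<le> ereal (obj z)" using that by (rule weak)
      finally show ?thesis unfolding z(2)[symmetric] by simp
    qed
    then show "\<exists>l \<nu> \<gamma>. is_arg_min obj (\<lambda>z. z \<in> F) (x, l, \<nu>, \<gamma>)"
      using z(1) by (auto simp: is_arg_min_linorder)
  next
    assume "\<exists>l \<nu> \<gamma>. is_arg_min obj (\<lambda>z. z \<in> F) (x, l, \<nu>, \<gamma>)"
    then obtain l \<nu> \<gamma> where z: "(x, l, \<nu>, \<gamma>) \<in> F"
      and min: "\<And>z. z \<in> F \<Longrightarrow> obj (x, l, \<nu>, \<gamma>) \<le> obj z"
      by (auto simp: is_arg_min_linorder)
    \<comment> \<open>Each competitor \<open>y\<close> is lifted to a feasible point with objective
      \<open>V y\<close>, which the optimal point can be compared with.\<close>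
    have "V x \<le> V y" if y: "y \<in> X" for y
    proof -
      obtain l' \<nu>' \<gamma>' where z': "(y, l', \<nu>', \<gamma>') \<in> F" "ereal (obj (y, l', \<nu>', \<gamma>')) = V y"
        using strong[OF y] by blast
      have "V x \<le> ereal (obj (x, l, \<nu>, \<gamma>))" using weak[OF z] by simp
      also have "\<dots> \<le> V y" using min[OF z'(1)] unfolding z'(2)[symmetric] by simp
      finally show ?thesis .
    qed
    then show "is_arg_min V (\<lambda>x. x \<in> X) x" using x by (simp add: is_arg_min_linorder)
  qed
  ultimately show ?thesis unfolding V_def F_def obj_def by blast
qed

end
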